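(* For every odd integer $n\ge 3$, $\chi'_L(K_n)=n$, where $K_n$ is the complete graph on $n$ vertices.
   Context: For a proper edge coloring $c:E(G)\to\{1,\dots,k\}$ of a connected graph $G$, let $\pi=(\mathcal{C}_1,\dots,\mathcal{C}_k)$ be the ordered partition of $E(G)$ into color classes. For a vertex $v$ and an edge $e=xy$, $d(v,e)=\min\{d(v,x),d(v,y)\}$, and $d(v,\mathcal{C}_i)=\min\{d(v,e): e\in\mathcal{C}_i\}$. The edge color code of $v$ is $c_\pi(v)=(d(v,\mathcal{C}_1),\dots,d(v,\mathcal{C}_k))$. The coloring $c$ is an edge-locating coloring if distinct vertices have distinct edge color codes; $\chi'_L(G)$ is the minimum $k$ for which $G$ has an edge-locating coloring with $k$ colors. *)

theory Defs
  imports Main "HOL-Library.Extended_Nat"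
begin

text \<open>An undirected simple graph is given by its vertex set and its set of edges, the latter
  being two-element subsets of the vertex set.\<close>

definition simple_graph :: "'a set \<Rightarrow> 'a set set \<Rightarrow> bool" where
  "simple_graph V E \<longleftrightarrow> finite V \<and> (\<forall>e\<in>E. e \<subseteq> V \<and> card e = 2)"

definition walk :: "'a set \<Rightarrow> 'a set set \<Rightarrow> 'a list \<Rightarrow> bool" where
  "walk V E xs \<longleftrightarrow> xs \<noteq> [] \<and> set xs \<subseteq> V \<and> successively (\<lambda>x y. {x, y} \<in> E) xs"

definition connected_graph :: "'a set \<Rightarrow> 'a set set \<Rightarrow> bool" where
  "connected_graph V E \<longleftrightarrow> simple_graph V E \<and> V \<noteq> {} \<and>
    (\<forall>u\<in>V. \<forall>v\<in>V. \<exists>xs. walk V E xs \<and> hd xs = u \<and> last xs = v)"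

text \<open>Distances take values in \<^typ>\<open>enat\<close>, so that an infimum over the empty set is
  \<open>\<infinity>\<close>. In a connected graph, and for nonempty color classes, all infima below are minima and
  all distances are finite.\<close>

definition vertex_dist :: "'a set \<Rightarrow> 'a set set \<Rightarrow> 'a \<Rightarrow> 'a \<Rightarrow> enat" where
  "vertex_dist V E u v =
    (INF xs \<in> {xs. walk V E xs \<and> hd xs = u \<and> last xs = v}. enat (length xs - 1))"

definition edge_dist :: "'a set \<Rightarrow> 'a set set \<Rightarrow> 'a \<Rightarrow> 'a set \<Rightarrow> enat" where
  "edge_dist V E v e = (INF x \<in> e. vertex_dist V E v x)"

definition class_dist :: "'a set \<Rightarrow> 'a set set \<Rightarrow> 'a \<Rightarrow> 'a set set \<Rightarrow> enat" where
  "class_dist V E v C = (INF e \<in> C. edge_dist V E v e)"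

definition color_class :: "'a set set \<Rightarrow> ('a set \<Rightarrow> nat) \<Rightarrow> nat \<Rightarrow> 'a set set" where
  "color_class E c i = {e \<in> E. c e = i}"

text \<open>The colors are exactly \<open>1, \<dots>, k\<close>: every color is used, so that the color classes form a
  partition of \<open>E\<close> into \<open>k\<close> (nonempty) parts.\<close>

definition proper_edge_coloring :: "'a set set \<Rightarrow> nat \<Rightarrow> ('a set \<Rightarrow> nat) \<Rightarrow> bool" where
  "proper_edge_coloring E k c \<longleftrightarrow> c ` E = {1..k} \<and>
    (\<forall>e\<in>E. \<forall>f\<in>E. e \<noteq> f \<and> e \<inter> f \<noteq> {} \<longrightarrow> c e \<noteq> c f)"

definition edge_color_code ::
    "'a set \<Rightarrow> 'a set set \<Rightarrow> nat \<Rightarrow> ('a set \<Rightarrow> nat) \<Rightarrow> 'a \<Rightarrow> enat list" where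
  "edge_color_code V E k c v = map (\<lambda>i. class_dist V E v (color_class E c i)) [1..<Suc k]"

definition edge_locating_coloring ::
    "'a set \<Rightarrow> 'a set set \<Rightarrow> nat \<Rightarrow> ('a set \<Rightarrow> nat) \<Rightarrow> bool" where
  "edge_locating_coloring V E k c \<longleftrightarrow>
    proper_edge_coloring E k c \<and> inj_on (edge_color_code V E k c) V"

text \<open>Not every connected graph has an edge-locating coloring (a single edge has none); the value
  is then \<open>\<infinity>\<close>. A finite value is thus attained by some edge-locating coloring.\<close>

definition edge_locating_chromatic_number :: "'a set \<Rightarrow> 'a set set \<Rightarrow> enat" where
  "edge_locating_chromatic_number V E = (INF k \<in> {k. \<exists>c. edge_locating_coloring V E k c}. enat k)"

definition complete_edges :: "'a set \<Rightarrow> 'a set set" where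
  "complete_edges V = {e. e \<subseteq> V \<and> card e = 2}"

lemma connected_graph_complete:
  assumes "finite V" "V \<noteq> {}"
  shows "connected_graph V (complete_edges V)"
proof -
  have "\<exists>xs. walk V (complete_edges V) xs \<and> hd xs = u \<and> last xs = v"
    if "u \<in> V" "v \<in> V" for u v
  proof (cases "u = v")
    case True
    with that show ?thesis by (intro exI[of _ "[u]"]) (simp add: walk_def)
  next
    case False
    with that show ?thesis
      by (intro exI[of _ "[u, v]"]) (simp add: walk_def complete_edges_def)
  qed
  with assms show ?thesis
    by (simp add: connected_graph_def simple_graph_def complete_edges_def)
qed

end

theory Submission
  imports Defs "HOL-Number_Theory.Cong"
begin

text \<open>A color class is a matching, so for odd \<open>n\<close> it misses a vertex and has at most \<open>(n - 1) / 2\<close>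
  edges; hence at least \<open>n\<close> colors are needed. Conversely, label the vertices by residues modulo
  \<open>n\<close> and color \<open>{x, y}\<close> by \<open>x + y\<close>. The only color missing at \<open>x\<close> is \<open>2 x\<close>, and these
  are distinct as \<open>n\<close> is odd. An entry of the code is \<open>0\<close> exactly if the color is present at
  the vertex, so the code determines the missing color and thus the vertex.\<close>

text \<open>In \<open>enat\<close>, being 0 means lying strictly below 1, and an infimum lies
  strictly below a bound exactly if some member does.\<close>

lemma enat_INF_eq_0_iff: "(INF x\<in>A. f x :: enat) = 0 \<longleftrightarrow> (\<exists>x\<in>A. f x = 0)"
  using INF_less_iff[of f A "eSuc 0"] by (simp only: iless_eSuc0)

lemma vertex_dist_eq_0_iff:
  assumes "v \<in> V"
  shows "vertex_dist V E v x = 0 \<longleftrightarrow> x = v"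
proof
  assume "vertex_dist V E v x = 0"
  then obtain xs where "xs \<noteq> []" "hd xs = v" "last xs = x" "length xs - 1 = 0"
    by (auto simp: vertex_dist_def enat_INF_eq_0_iff walk_def enat_0_iff)
  then show "x = v" by (cases xs) auto
next
  assume "x = v"
  with assms have "walk V E [v] \<and> hd [v] = v \<and> last [v] = x" by (simp add: walk_def)
  then show "vertex_dist V E v x = 0"
    unfolding vertex_dist_def enat_INF_eq_0_iff
    by (intro bexI[of _ "[v]"]) (auto simp: zero_enat_def)
qed

text \<open>Only whether a code entry is zero matters below, so no positive distance is ever
  computed.\<close>

lemma class_dist_eq_0_iff:
  assumes "v \<in> V"
  shows "class_dist V E v C = 0 \<longleftrightarrow> (\<exists>e\<in>C. v \<in> e)"
  using assms
  by (auto simp: class_dist_def edge_dist_def enat_INF_eq_0_iff vertex_dist_eq_0_iff)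

lemma edge_color_code_eqD:
  assumes "edge_color_code V E k c v = edge_color_code V E k c w" "i \<in> {1..k}"
  shows "class_dist V E v (color_class E c i) = class_dist V E w (color_class E c i)"
  using assms by (auto simp: edge_color_code_def simp del: upt_Suc)

lemma card_matching_le:
  assumes "finite V" "pairwise disjnt M" "\<And>e. e \<in> M \<Longrightarrow> e \<subseteq> V \<and> card e = 2"
  shows "2 * card M \<le> card V"
proof -
  have "card (\<Union>M) = sum card M"
    using assms by (intro card_Union_disjoint) (auto intro: finite_subset)
  also have "\<dots> = 2 * card M" using assms(3) by simp
  finally show ?thesis using assms by (metis Sup_le_iff card_mono)
qed

lemma complete_edges_coloring_ge:
  assumes "card V = n" "odd n" "n \<ge> 3"
    and col: "proper_edge_coloring (complete_edges V) k c"
  shows "n \<le> k"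
proof -
  let ?E = "complete_edges V"
  \<comment> \<open>An infinite set has \<open>card\<close> 0, so \<open>n \<ge> 3\<close> forces
    finiteness.\<close>
  have fin: "finite V" using assms by (auto intro: card_ge_0_finite)
  obtain m where m: "n = 2 * m + 1" using \<open>odd n\<close> by (rule oddE)
  have le: "card (color_class ?E c i) \<le> m" for i
  proof -
    have "pairwise disjnt (color_class ?E c i)"
      using col unfolding pairwise_def disjnt_def color_class_def proper_edge_coloring_def
      by blast
    then have "2 * card (color_class ?E c i) \<le> card V"
      by (intro card_matching_le fin) (auto simp: color_class_def complete_edges_def)
    then show ?thesis using assms m by simp
  qed
  have E: "?E = (\<Union>i\<in>{1..k}. color_class ?E c i)"
    using col by (auto simp: color_class_def proper_edge_coloring_def)
  \<comment> \<open>For \<open>n = 2 * m + 1\<close>, the binomial coefficient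
    \<open>n choose 2\<close> is \<open>n * m\<close>.\<close>
  have "n * m = card ?E"
    using n_subsets[OF fin, of 2] assms(1) m by (simp add: complete_edges_def choose_two)
  also have "\<dots> \<le> (\<Sum>i\<in>{1..k}. card (color_class ?E c i))"
    by (subst E) (rule card_UN_le, simp)
  also have "\<dots> \<le> (\<Sum>i\<in>{1..k}. m)" by (rule sum_mono) (rule le)
  finally have "n * m \<le> k * m" by simp
  moreover have "m > 0" using m assms(3) by simp
  ultimately show ?thesis by (simp only: mult_le_cancel2)
qed

lemma mod_add_left_cancel_nat:
  fixes a x y n :: nat
  assumes "(a + x) mod n = (a + y) mod n" "x < n" "y < n"
  shows "x = y"
  using assms by (metis cong_def cong_add_lcancel_nat mod_less)

text \<open>As 2 is coprime to an odd modulus, it can be cancelled.\<close>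

lemma mod_double_cancel_nat:
  fixes x y n :: nat
  assumes "odd n" "(2 * x) mod n = (2 * y) mod n" "x < n" "y < n"
  shows "x = y"
  using assms by (metis cong_def cong_mult_lcancel_nat coprime_left_2_iff_odd mod_less)

lemma complete_edges_locating_coloring:
  assumes "card V = n" "odd n" "n \<ge> 3"
  shows "\<exists>c. edge_locating_coloring V (complete_edges V) n c"
proof -
  let ?E = "complete_edges V"
  have "finite V" using assms by (auto intro: card_ge_0_finite)
  then obtain f where f: "bij_betw f V {0..<n}"
    using ex_bij_betw_finite_nat assms(1) by blast
  have lt: "f x < n" if "x \<in> V" for x using f that by (auto simp: bij_betw_def)
  have inj: "x = y" if "f x = f y" "x \<in> V" "y \<in> V" for x y
    using f that by (auto simp: bij_betw_def inj_on_def)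
  have surj: "\<exists>x\<in>V. f x = i" if "i < n" for i
    using bij_betw_imp_surj_on[OF f] that by (metis atLeastLessThan_iff imageE le0)
  \<comment> \<open>\<open>Suc\<close> shifts the residues below \<open>n\<close> to the colors from
    1 to \<open>n\<close>.\<close>
  define c where "c e = Suc (sum f e mod n)" for e
  have c_edge: "c {x, y} = Suc ((f x + f y) mod n)" if "x \<noteq> y" for x y
    using that by (simp add: c_def)
  have edge: "\<exists>x. e = {v, x} \<and> v \<noteq> x \<and> v \<in> V \<and> x \<in> V" if "e \<in> ?E" "v \<in> e" for e v
    using that by (auto simp: complete_edges_def card_2_iff)
  have present: "\<exists>e\<in>?E. v \<in> e \<and> c e = Suc s"
    if "v \<in> V" "s < n" "(2 * f v) mod n \<noteq> s" for v s
  proof -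
    \<comment> \<open>The label of \<open>x\<close> is \<open>s - f v\<close> modulo
      \<open>n\<close>; adding \<open>n\<close> first keeps the subtraction on naturals from being
      truncated.\<close>
    obtain x where x: "x \<in> V" "f x = (s + n - f v) mod n"
      using surj[of "(s + n - f v) mod n"] assms by auto
    have s: "(f v + f x) mod n = s"
      using lt[OF that(1)] that(2) by (simp add: x mod_add_right_eq)
    with that have "v \<noteq> x" by (auto simp: mult_2)
    then show ?thesis using that x s
      by (intro bexI[of _ "{v, x}"]) (auto simp: c_edge complete_edges_def)
  qed
  \<comment> \<open>Cancelling \<open>f v\<close> would give the other endpoint the label of
    \<open>v\<close>.\<close>
  have missing: "c e \<noteq> Suc ((2 * f v) mod n)" if ve: "e \<in> ?E" "v \<in> e" for e v
  proof
    assume eq: "c e = Suc ((2 * f v) mod n)"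
    obtain x where x: "e = {v, x}" "v \<noteq> x" "v \<in> V" "x \<in> V" using edge[OF ve] by blast
    then have "(f v + f x) mod n = (f v + f v) mod n" using eq by (simp add: c_edge mult_2)
    then show False using mod_add_left_cancel_nat lt inj x by blast
  qed
  have "proper_edge_coloring ?E n c"
    unfolding proper_edge_coloring_def
  proof (intro conjI ballI impI)
    show "c ` ?E = {1..n}"
    proof
      show "c ` ?E \<subseteq> {1..n}" using assms by (auto simp: c_def Suc_le_eq)
    next
      show "{1..n} \<subseteq> c ` ?E"
      proof
        fix i assume "i \<in> {1..n}"
        then obtain s where s: "i = Suc s" "s < n" by (cases i) auto
        \<comment> \<open>To see that color \<open>Suc s\<close> is used, take a vertex not missing
          it: label 0 misses residue 0, and label 1 misses residue 2, which is nonzero modulo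
          \<open>n\<close> as \<open>n \<ge> 3\<close>.\<close>
        have "(if s = 0 then 1 else 0) < n" using assms by simp
        then obtain v where "v \<in> V" "f v = (if s = 0 then 1 else 0)"
          using surj by blast
        moreover from this have "(2 * f v) mod n \<noteq> s" using assms by auto
        ultimately show "i \<in> c ` ?E" using present[of v s] s by (metis imageI)
      qed
    qed
  next
    fix e g assume e: "e \<in> ?E" and g: "g \<in> ?E" and eg: "e \<noteq> g \<and> e \<inter> g \<noteq> {}"
    then obtain v where "v \<in> e" "v \<in> g" by blast
    then obtain x y where xy: "e = {v, x}" "v \<noteq> x" "x \<in> V" "g = {v, y}" "v \<noteq> y" "y \<in> V"
      using edge e g by meson
    show "c e \<noteq> c g"
    proof
      assume "c e = c g"
      then have "(f v + f x) mod n = (f v + f y) mod n" using xy by (simp add: c_edge)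
      then have "x = y" using mod_add_left_cancel_nat lt inj xy by blast
      with eg xy show False by simp
    qed
  qed
  moreover have "inj_on (edge_color_code V ?E n c) V"
  proof
    fix v w assume v: "v \<in> V" and w: "w \<in> V"
      and code: "edge_color_code V ?E n c v = edge_color_code V ?E n c w"
    let ?s = "(2 * f v) mod n"
    have s: "?s < n" using assms by simp
    \<comment> \<open>Equal codes make the color missing at \<open>v\<close> missing at
      \<open>w\<close> too, and \<open>present\<close> leaves only one candidate there.\<close>
    have "class_dist V ?E v (color_class ?E c (Suc ?s)) = class_dist V ?E w (color_class ?E c (Suc ?s))"
      using edge_color_code_eqD[OF code] s by simp
    moreover have "class_dist V ?E v (color_class ?E c (Suc ?s)) \<noteq> 0"
      using missing by (auto simp: class_dist_eq_0_iff[OF v] color_class_def)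
    ultimately have "\<not> (\<exists>e\<in>?E. w \<in> e \<and> c e = Suc ?s)"
      using class_dist_eq_0_iff[OF w] by (auto simp: color_class_def)
    then have "(2 * f w) mod n = ?s" using present[OF w s] by blast
    then show "v = w" using mod_double_cancel_nat[OF assms(2)] lt inj v w by metis
  qed
  ultimately show ?thesis unfolding edge_locating_coloring_def by blast
qed

theorem theorem9:
  fixes V :: "'a set" and n :: nat
  assumes "card V = n" and "odd n" and "n \<ge> 3"
  shows "edge_locating_chromatic_number V (complete_edges V) = enat n"
  unfolding edge_locating_chromatic_number_def
proof (rule antisym)
  show "(INF k\<in>{k. \<exists>c. edge_locating_coloring V (complete_edges V) k c}. enat k) \<le> enat n"
    using complete_edges_locating_coloring[OF assms] by (intro INF_lower) simp
  show "enat n \<le> (INF k\<in>{k. \<exists>c. edge_locating_coloring V (complete_edges V) k c}. enat k)"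
    using complete_edges_coloring_ge[OF assms]
    by (intro INF_greatest) (auto simp: edge_locating_coloring_def)
qed

end
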